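(* Let $X$ be a real Hilbert space, and let $A:X\to X$ be a potential operator, with sequentially weakly upper semicontinuous potential $P:X\to\mathbb{R}$. For each $\rho>0$, put $$\varphi(\rho)=\inf_{\|x\|^2<\rho}\frac{\sup_{\|y\|^2\leq\rho}P(y)-P(x)}{\rho-\|x\|^2}.$$ Furthermore, set $$\gamma=\liminf_{\rho\to+\infty}\varphi(\rho)\quad\text{and}\quad\delta=\liminf_{\rho\to0^+}\varphi(\rho).$$ Then the following conclusions hold: (a) If there is $\rho>0$ such that $\varphi(\rho)<\frac12$, then the operator $A$ has a fixed point whose norm is less than $\sqrt{\rho}$. (b) If $\gamma<\frac12$, then the following alternative holds: either the functional $x\mapsto\frac12\|x\|^2-P(x)$ has a global minimum, or the set of all fixed points of $A$ is unbounded. (c) If $\delta<\frac12$, then the following alternative holds: either $0$ is a local minimum of the functional $x\mapsto\frac12\|x\|^2-P(x)$, or there exists a sequence of pairwise distinct fixed points of $A$ which weakly converges to $0$.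
   Context: Given a real Hilbert space $X$, an operator $A:X\to X$ is said to be a potential operator if there exists a Gâteaux differentiable functional $P:X\to\mathbb{R}$ (called a potential of $A$) such that $P'=A$ (the Gâteaux derivative being identified with an element of $X$ via the Riesz representation). No further continuity is assumed on $A$. A functional having a global minimum means that its infimum over $X$ is attained; local minima are with respect to the norm topology. *)

theory Defs
  imports "HOL-Analysis.Analysis"
begin

definition has_gateaux_derivative ::
    "('a::real_normed_vector \<Rightarrow> real) \<Rightarrow> ('a \<Rightarrow> real) \<Rightarrow> 'a \<Rightarrow> bool" where
  "has_gateaux_derivative P D x \<longleftrightarrow>
     bounded_linear D \<and>
     (\<forall>h. ((\<lambda>t. (P (x + t *\<^sub>R h) - P x) / t) \<longlongrightarrow> D h) (at 0))"

text \<open>The derivative at \<open>x\<close>, an element of the dual, is identified with the vector \<open>A x\<close>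
  representing it.\<close>

definition is_potential :: "('a::real_inner \<Rightarrow> real) \<Rightarrow> ('a \<Rightarrow> 'a) \<Rightarrow> bool" where
  "is_potential P A \<longleftrightarrow> (\<forall>x. has_gateaux_derivative P (\<lambda>h. A x \<bullet> h) x)"

definition potential_operator :: "('a::real_inner \<Rightarrow> 'a) \<Rightarrow> bool" where
  "potential_operator A \<longleftrightarrow> (\<exists>P. is_potential P A)"

definition weakly_tendsto :: "(nat \<Rightarrow> 'a::real_normed_vector) \<Rightarrow> 'a \<Rightarrow> bool" where
  "weakly_tendsto u x \<longleftrightarrow>
     (\<forall>f :: 'a \<Rightarrow> real. bounded_linear f \<longrightarrow> (\<lambda>n. f (u n)) \<longlonglongrightarrow> f x)"

definition seq_weakly_usc :: "('a::real_normed_vector \<Rightarrow> real) \<Rightarrow> bool" where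
  "seq_weakly_usc P \<longleftrightarrow>
     (\<forall>u x. weakly_tendsto u x \<longrightarrow> limsup (\<lambda>n. ereal (P (u n))) \<le> ereal (P x))"

text \<open>The values are extended reals, so that suprema and infima are meaningful without any
  boundedness side condition. The divisor is a positive real for every \<open>x\<close> that is considered.\<close>

definition phi :: "('a::real_normed_vector \<Rightarrow> real) \<Rightarrow> real \<Rightarrow> ereal" where
  "phi P \<rho> =
     (INF x \<in> {x. (norm x)\<^sup>2 < \<rho>}.
        ((SUP y \<in> {y. (norm y)\<^sup>2 \<le> \<rho>}. ereal (P y)) - ereal (P x)) / ereal (\<rho> - (norm x)\<^sup>2))"

end

theory Submission
  imports Defs
begin

text \<open>
  Write \<open>J x = \<parallel>x\<parallel>\<^sup>2 / 2 - P x\<close>. Where \<open>J\<close> has a local minimum its Gateaux derivative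
  \<open>h \<mapsto> (x - A x) \<bullet> h\<close> vanishes, so local minima of \<open>J\<close> are fixed points of \<open>A\<close>.

  On a closed ball \<open>J\<close> attains its minimum, because \<open>J\<close> is sequentially weakly lower
  semicontinuous and bounded sequences in a Hilbert space have weakly convergent subsequences
  (\<open>bounded_imp_weakly_convergent_subsequence\<close>). The condition \<open>\<phi>(\<rho>) < 1/2\<close> says exactly that
  some point \<open>z\<close> of the open ball of radius \<open>\<surd>\<rho>\<close> satisfies
  \<open>J z < \<rho>/2 - sup P\<close>, the supremum being over the closed ball. The right-hand side bounds \<open>J\<close>
  from below on the sphere, so the minimum over the ball is attained in the interior, at a fixed
  point (\<open>phi_less_half_imp_fixed_point_minimum\<close>). This is (a).

  For (b), the condition holds for arbitrarily large \<open>\<rho>\<close>. If the fixed points all lie in one ball,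
  the minimum over that ball is no larger than the minimum over any larger admissible ball, since
  the latter is attained at a fixed point; hence it is global. For (c), the condition holds for
  arbitrarily small \<open>\<rho>\<close>. If \<open>0\<close> is not a local minimum of \<open>J\<close>, the resulting fixed points are
  nonzero with arbitrarily small norm, so a sequence of distinct ones tends to \<open>0\<close> even in norm.
\<close>

section \<open>Weak sequential compactness of bounded sets in a Hilbert space\<close>

text \<open>
  The points of almost minimal norm in the sets \<open>C n\<close> form a Cauchy sequence: the midpoint of two
  of them lies in the larger set, so its norm is not much smaller than theirs, and the
  parallelogram identity then forces the two points to be close. The limit lies in every \<open>C n\<close>.
\<close>
lemma Inter_nested_closed_convex_nonempty:
  fixes C :: "nat \<Rightarrow> 'a::{real_inner, complete_space} set"
  assumes "\<And>n. closed (C n)" "\<And>n. convex (C n)" "\<And>n. C n \<noteq> {}"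
    and dec: "decseq C" and bdd: "bounded (C 0)"
  shows "(\<Inter>n. C n) \<noteq> {}"
proof -
  define d where "d n = (INF z\<in>C n. (norm z)\<^sup>2)" for n
  have sub: "C m \<subseteq> C n" if "n \<le> m" for m n
    using dec that by (simp add: decseq_def)
  have bb: "bdd_below ((\<lambda>z. (norm z)\<^sup>2) ` C n)" for n
    by (rule bdd_belowI[of _ 0]) auto
  have d_le: "d n \<le> (norm z)\<^sup>2" if "z \<in> C n" for n z
    unfolding d_def by (rule cINF_lower[OF bb that])
  have d_mono: "d n \<le> d m" if "n \<le> m" for n m
    unfolding d_def by (rule cINF_superset_mono) (use assms bb sub[OF that] in auto)
  obtain B where B: "\<And>z. z \<in> C 0 \<Longrightarrow> norm z \<le> B"
    using bdd by (auto simp: bounded_iff)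
  have "d n \<le> B\<^sup>2" for n
  proof -
    obtain z where "z \<in> C n" using assms by blast
    with B[of z] sub[of 0 n] have "norm z \<le> B" by auto
    then have "(norm z)\<^sup>2 \<le> B\<^sup>2" by (simp add: power_mono)
    with d_le[OF \<open>z \<in> C n\<close>] show ?thesis by simp
  qed
  then obtain L where L: "d \<longlonglongrightarrow> L" and dL: "\<And>n. d n \<le> L"
    using incseq_convergent[of d] d_mono by (metis incseq_def)
  have "\<exists>z\<in>C n. (norm z)\<^sup>2 < d n + inverse (real (Suc n))" for n
    using cINF_less_iff[of "C n" "\<lambda>z. (norm z)\<^sup>2" "d n + inverse (real (Suc n))"] assms bb
    by (simp add: d_def)
  then obtain x where x: "\<And>n. x n \<in> C n" "\<And>n. (norm (x n))\<^sup>2 < d n + inverse (real (Suc n))"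
    by metis
  define e where "e n = 2 * (L - d n) + 4 * inverse (real (Suc n))" for n
  \<comment> \<open>Parallelogram identity, applied to the midpoint of \<open>x n\<close> and \<open>x m\<close>.\<close>
  have est: "(dist (x n) (x m))\<^sup>2 \<le> e n" if "n \<le> m" for n m
  proof -
    have "(1/2) *\<^sub>R x n + (1/2) *\<^sub>R x m \<in> C n"
      using convexD[OF assms(2), of "x n" n "x m" "1/2" "1/2"] x(1) sub[OF that] by auto
    from d_le[OF this] have "4 * d n \<le> 4 * (norm ((1/2) *\<^sub>R x n + (1/2) *\<^sub>R x m))\<^sup>2"
      by simp
    also have "\<dots> = 2 * (norm (x n))\<^sup>2 + 2 * (norm (x m))\<^sup>2 - (dist (x n) (x m))\<^sup>2"
      by (simp add: dist_norm power2_norm_eq_inner algebra_simps inner_commute)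
    finally have "(dist (x n) (x m))\<^sup>2 \<le> 2 * (norm (x n))\<^sup>2 + 2 * (norm (x m))\<^sup>2 - 4 * d n"
      by simp
    moreover have "inverse (real (Suc m)) \<le> inverse (real (Suc n))"
      using that by simp
    ultimately show ?thesis
      using x(2)[of n] x(2)[of m] dL[of m] unfolding e_def by argo
  qed
  have "e \<longlonglongrightarrow> 2 * (L - L) + 4 * 0"
    unfolding e_def by (intro tendsto_intros L LIMSEQ_inverse_real_of_nat)
  then have e0: "e \<longlonglongrightarrow> 0" by simp
  have "Cauchy x"
  proof (rule metric_CauchyI)
    fix r :: real assume "0 < r"
    then have "\<forall>\<^sub>F n in sequentially. e n < (r/2)\<^sup>2"
      using order_tendstoD(2)[OF e0] by simp
    then obtain N where N: "e N < (r/2)\<^sup>2" by (auto simp: eventually_sequentially)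
    have "dist (x N) (x m) < r/2" if "N \<le> m" for m
      by (rule power2_less_imp_less) (use est[OF that] N \<open>0 < r\<close> in auto)
    then show "\<exists>M. \<forall>m\<ge>M. \<forall>n\<ge>M. dist (x m) (x n) < r"
      by (meson dist_triangle_half_r)
  qed
  then obtain l where l: "x \<longlonglongrightarrow> l" using Cauchy_convergent_iff convergentD by blast
  have "l \<in> C n" for n
    by (rule Lim_in_closed_set[OF assms(1) _ _ l])
      (use x(1) sub in \<open>auto intro!: eventually_sequentiallyI[of n]\<close>)
  then show ?thesis by blast
qed

text \<open>
  If a sequence converges weakly, its limit lies in this set. For a bounded sequence the set is
  never empty, so it supplies a candidate for the weak limit without representing functionals.
\<close>
definition tail_hulls :: "(nat \<Rightarrow> 'a::real_normed_vector) \<Rightarrow> 'a set" where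
  "tail_hulls w = (\<Inter>n. closure (convex hull (w ` {n..})))"

lemma tail_hulls_nonempty:
  fixes w :: "nat \<Rightarrow> 'a::{real_inner, complete_space}"
  assumes "bounded (range w)"
  shows "tail_hulls w \<noteq> {}"
  unfolding tail_hulls_def
proof (rule Inter_nested_closed_convex_nonempty)
  show "decseq (\<lambda>n. closure (convex hull (w ` {n..})))"
    by (intro decseq_SucI closure_mono hull_mono image_mono) auto
  show "bounded (closure (convex hull (w ` {0..})))"
    using assms by (simp add: bounded_closure bounded_convex_hull atLeast_0)
qed (auto intro: convex_closure)

text \<open>
  The preimage under \<open>g\<close> of a small interval around \<open>c\<close> is closed and convex and contains a tail
  of the sequence, hence the closed convex hull of that tail.
\<close>
lemma tail_hulls_linear_limit:
  fixes g :: "'a::real_normed_vector \<Rightarrow> real"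
  assumes g: "bounded_linear g" and lim: "(\<lambda>n. g (w n)) \<longlonglongrightarrow> c" and x: "x \<in> tail_hulls w"
  shows "g x = c"
proof -
  have "dist (g x) c \<le> e" if "e > 0" for e
  proof -
    from lim that have "\<forall>\<^sub>F n in sequentially. dist (g (w n)) c < e" by (simp add: tendsto_iff)
    then obtain N where N: "\<And>n. n \<ge> N \<Longrightarrow> dist (g (w n)) c < e"
      by (auto simp: eventually_sequentially)
    have "closure (convex hull (w ` {N..})) \<subseteq> g -` cball c e"
    proof (intro closure_minimal hull_minimal)
      show "w ` {N..} \<subseteq> g -` cball c e" using N by (force simp: dist_commute)
      show "convex (g -` cball c e)"
        using g by (intro convex_linear_vimage bounded_linear.linear) auto
      show "closed (g -` cball c e)"
        using g by (intro closed_vimage linear_continuous_on) auto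
    qed
    with x show ?thesis unfolding tail_hulls_def by (auto simp: dist_commute)
  qed
  then have "dist (g x) c \<le> 0" by (rule field_le_epsilon) simp
  then show ?thesis by simp
qed

text \<open>
  Let \<open>x\<close> be a point of \<open>tail_hulls v\<close>. If \<open>f (v n)\<close> failed to converge to \<open>f x\<close>, it would converge
  to another value \<open>c\<close> along some subsequence, and \<open>f y = c\<close> for each \<open>y\<close> in the tail hulls of that
  subsequence. But \<open>x\<close> and \<open>y\<close> have the same inner product with each \<open>v m\<close>, and both lie in the
  closed convex hull of the \<open>v m\<close>; so \<open>x - y\<close> is orthogonal to itself.
\<close>
lemma weakly_tendsto_of_inner_convergent:
  fixes v :: "nat \<Rightarrow> 'a::{real_inner, complete_space}"
  assumes bdd: "bounded (range v)" and conv: "\<And>m. convergent (\<lambda>n. v n \<bullet> v m)"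
  shows "\<exists>x. weakly_tendsto v x"
proof -
  obtain x where x: "x \<in> tail_hulls v" using tail_hulls_nonempty[OF bdd] by blast
  have "(\<lambda>n. f (v n)) \<longlonglongrightarrow> f x" if f: "bounded_linear f" for f :: "'a \<Rightarrow> real"
  proof (rule ccontr)
    assume "\<not> ?thesis"
    then obtain e where e: "e > 0" and "\<not> (\<forall>\<^sub>F n in sequentially. dist (f (v n)) (f x) < e)"
      by (auto simp: tendsto_iff)
    then have inf: "infinite {n. \<not> dist (f (v n)) (f x) < e}"
      by (simp add: cofinite_eq_sequentially[symmetric] eventually_cofinite)
    define s where "s = enumerate {n. \<not> dist (f (v n)) (f x) < e}"
    have s: "strict_mono s" "\<And>n. e \<le> dist (f (v (s n))) (f x)"
      using inf enumerate_in_set[OF inf] by (auto simp: s_def strict_mono_enumerate not_less)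
    have "bounded (range (\<lambda>n. f (v (s n))))"
      by (rule bounded_subset[OF bounded_linear_image[OF bdd f]]) auto
    then obtain c t where t: "strict_mono t" and c: "(\<lambda>n. f (v (s (t n)))) \<longlonglongrightarrow> c"
      using bounded_imp_convergent_subsequence by (fastforce simp: o_def)
    define w where "w n = v (s (t n))" for n
    have sub: "strict_mono (\<lambda>n. s (t n))" using s(1) t by (simp add: strict_mono_def)
    have "bounded (range w)" by (rule bounded_subset[OF bdd]) (auto simp: w_def)
    then obtain y where y: "y \<in> tail_hulls w" using tail_hulls_nonempty by blast
    have fy: "f y = c" by (rule tail_hulls_linear_limit[OF f _ y]) (use c in \<open>simp add: w_def\<close>)
    have orth: "(x - y) \<bullet> v m = 0" for m
    proof -
      obtain l where l: "(\<lambda>n. v n \<bullet> v m) \<longlonglongrightarrow> l" using conv convergentD by blast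
      then have l': "(\<lambda>n. w n \<bullet> v m) \<longlonglongrightarrow> l"
        using LIMSEQ_subseq_LIMSEQ[OF l sub] by (simp add: o_def w_def)
      have "x \<bullet> v m = l" by (rule tail_hulls_linear_limit[OF bounded_linear_inner_left l x])
      moreover have "y \<bullet> v m = l"
        by (rule tail_hulls_linear_limit[OF bounded_linear_inner_left l' y])
      ultimately show ?thesis by (simp add: inner_diff_left)
    qed
    have "closure (convex hull (range v)) \<subseteq> {z. (x - y) \<bullet> z = 0}"
      using orth by (intro closure_minimal hull_minimal closed_hyperplane convex_hyperplane) auto
    moreover have "x \<in> closure (convex hull (range v))"
      using x by (auto simp: tail_hulls_def atLeast_0 dest: spec[of _ 0])
    moreover have "y \<in> closure (convex hull (range v))"
    proof -
      have "closure (convex hull (w ` {0..})) \<subseteq> closure (convex hull (range v))"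
        by (intro closure_mono hull_mono) (auto simp: w_def)
      with y show ?thesis unfolding tail_hulls_def by blast
    qed
    ultimately have "(x - y) \<bullet> x = 0" "(x - y) \<bullet> y = 0" by auto
    then have "(x - y) \<bullet> (x - y) = 0" by (simp add: inner_diff_right)
    then have "x = y" by simp
    have "(\<lambda>n. dist (f (v (s (t n)))) (f x)) \<longlonglongrightarrow> dist c (f x)"
      by (intro tendsto_intros c)
    then have "e \<le> dist c (f x)" by (rule LIMSEQ_le_const) (use s(2) in auto)
    with e fy \<open>x = y\<close> show False by simp
  qed
  then show ?thesis unfolding weakly_tendsto_def by blast
qed

text \<open>
  The functions \<open>m \<mapsto> u n \<bullet> u m\<close> lie in a product of countably many copies of one compact interval.
  Sequential compactness of that product replaces the diagonal argument: some subsequence makes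
  all inner products with the \<open>u m\<close> converge, in particular those with its own members.
\<close>
lemma bounded_imp_weakly_convergent_subsequence:
  fixes u :: "nat \<Rightarrow> 'a::{real_inner, complete_space}"
  assumes bdd: "bounded (range u)"
  shows "\<exists>r x. strict_mono r \<and> weakly_tendsto (u \<circ> r) x"
proof -
  obtain B where B: "\<And>n. norm (u n) \<le> B" using bdd by (auto simp: bounded_iff)
  define K :: "(nat \<Rightarrow> real) set" where "K = PiE UNIV (\<lambda>_. {- (B * B)..B * B})"
  have "compactin (product_topology (\<lambda>_::nat. euclidean) UNIV) K"
    unfolding K_def by (subst compactin_PiE) (simp add: compactin_euclidean_iff)
  then have "compact K"
    by (simp add: euclidean_product_topology compactin_euclidean_iff)
  then have seq: "seq_compact K" by (rule compact_imp_seq_compact)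
  have "\<bar>u n \<bullet> u m\<bar> \<le> B * B" for n m
    using Cauchy_Schwarz_ineq2[of "u n" "u m"] mult_mono[OF B[of n] B[of m]]
      norm_ge_zero[of "u n"] B[of n] by (smt (verit) norm_ge_zero)
  then have "\<forall>n. (\<lambda>m. u n \<bullet> u m) \<in> K"
    by (auto simp: K_def abs_le_iff) (smt (verit))
  then obtain l r where r: "strict_mono r" and "((\<lambda>n m. u n \<bullet> u m) \<circ> r) \<longlonglongrightarrow> l"
    using seq unfolding seq_compact_def by meson
  then have l: "(\<lambda>n m. u (r n) \<bullet> u m) \<longlonglongrightarrow> l" by (simp add: o_def)
  have "(\<lambda>n. u (r n) \<bullet> u m) \<longlonglongrightarrow> l m" for m
  proof -
    have "isCont (\<lambda>f::nat \<Rightarrow> real. f m) l"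
      using continuous_on_product_coordinates by (rule continuous_on_interior) simp
    from isCont_tendsto_compose[OF this l] show ?thesis .
  qed
  then have "\<exists>x. weakly_tendsto (u \<circ> r) x"
    by (intro weakly_tendsto_of_inner_convergent bounded_subset[OF bdd])
       (auto simp: convergent_def)
  with r show ?thesis by blast
qed

section \<open>Maxima of sequentially weakly upper semicontinuous functionals\<close>

lemma weakly_tendsto_inner:
  fixes u :: "nat \<Rightarrow> 'a::real_inner"
  assumes "weakly_tendsto u x"
  shows "(\<lambda>n. u n \<bullet> y) \<longlonglongrightarrow> x \<bullet> y"
  using assms bounded_linear_inner_left[of y] unfolding weakly_tendsto_def by blast

text \<open>
  Cauchy-Schwarz gives \<open>u n \<bullet> x \<le> r * norm x\<close>; the left-hand side tends to \<open>(norm x)\<^sup>2\<close>.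
\<close>
lemma weakly_tendsto_cball:
  fixes u :: "nat \<Rightarrow> 'a::real_inner"
  assumes "weakly_tendsto u x" and "\<And>n. u n \<in> cball 0 r"
  shows "x \<in> cball 0 r"
proof -
  have "u n \<bullet> x \<le> r * norm x" for n
    using norm_cauchy_schwarz[of "u n" x] assms(2)[of n]
    by (smt (verit) mem_cball_0 mult_right_mono norm_ge_zero)
  then have "x \<bullet> x \<le> r * norm x"
    by (intro LIMSEQ_le_const2[OF weakly_tendsto_inner[OF assms(1)]]) auto
  then have "norm x * norm x \<le> r * norm x" by (simp add: dot_square_norm power2_eq_square)
  moreover have "0 \<le> r"
    by (rule order_trans[OF norm_ge_zero[of "u 0"]]) (use assms(2)[of 0] in simp)
  ultimately show ?thesis by (cases "x = 0") auto
qed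

text \<open>
  The direct method: a subsequence of a maximizing sequence converges weakly inside the ball. The
  supremum is taken in the extended reals; that it is finite comes out of the argument.
\<close>
lemma seq_weakly_usc_attains_sup_on_cball:
  fixes F :: "'a::{real_inner, complete_space} \<Rightarrow> real"
  assumes "seq_weakly_usc F" and "r \<ge> 0"
  shows "\<exists>x\<in>cball 0 r. \<forall>y\<in>cball 0 r. F y \<le> F x"
proof -
  define S where "S = (SUP y\<in>cball 0 r. ereal (F y))"
  have "(\<lambda>y. ereal (F y)) ` cball 0 r \<noteq> {}" using assms(2) by auto
  from Sup_countable_SUP[OF this] obtain f where f: "incseq f"
    "range f \<subseteq> (\<lambda>y. ereal (F y)) ` cball 0 r" "S = (SUP i. f i)"
    unfolding S_def by blast
  then have "\<forall>n. \<exists>y\<in>cball 0 r. f n = ereal (F y)" by blast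
  then obtain u where u: "\<And>n. u n \<in> cball 0 r" "\<And>n. f n = ereal (F (u n))" by metis
  have lim: "(\<lambda>n. ereal (F (u n))) \<longlonglongrightarrow> S"
    using LIMSEQ_SUP[OF f(1)] unfolding f(3) u(2) .
  have "bounded (range u)" by (rule bounded_subset[OF bounded_cball[of 0 r]]) (use u(1) in auto)
  then obtain s x where s: "strict_mono s" and x: "weakly_tendsto (u \<circ> s) x"
    using bounded_imp_weakly_convergent_subsequence by blast
  have "limsup (\<lambda>n. ereal (F ((u \<circ> s) n))) = S"
    using LIMSEQ_subseq_LIMSEQ[OF lim s] by (intro lim_imp_Limsup) (auto simp: o_def)
  then have "S \<le> ereal (F x)"
    using assms(1) x unfolding seq_weakly_usc_def by metis
  moreover have "ereal (F y) \<le> S" if "y \<in> cball 0 r" for y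
    unfolding S_def using that by (rule SUP_upper)
  moreover have "x \<in> cball 0 r" using weakly_tendsto_cball[OF x] u(1) by simp
  ultimately show ?thesis by (meson ereal_less_eq(3) order_trans)
qed

text \<open>
  Since \<open>(norm (u - x))\<^sup>2 \<ge> 0\<close>, the concave term \<open>- (norm u)\<^sup>2 / 2\<close> lies below its tangent
  \<open>(norm x)\<^sup>2 / 2 - u \<bullet> x\<close> at \<open>x\<close>, which is affine in \<open>u\<close> and so converges along a weakly convergent
  sequence.
\<close>
lemma seq_weakly_usc_diff_half_norm_power2:
  fixes P :: "'a::real_inner \<Rightarrow> real"
  assumes "seq_weakly_usc P"
  shows "seq_weakly_usc (\<lambda>x. P x - 1/2 * (norm x)\<^sup>2)"
  unfolding seq_weakly_usc_def
proof (intro allI impI)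
  fix u and x :: 'a assume u: "weakly_tendsto u x"
  define a where "a n = 1/2 * (norm x)\<^sup>2 - u n \<bullet> x" for n
  have "a \<longlonglongrightarrow> 1/2 * (norm x)\<^sup>2 - x \<bullet> x"
    unfolding a_def by (intro tendsto_intros weakly_tendsto_inner u)
  then have a: "(\<lambda>n. ereal (a n)) \<longlonglongrightarrow> ereal (- (1/2) * (norm x)\<^sup>2)"
    by (simp add: power2_norm_eq_inner)
  have le: "- (1/2) * (norm (u n))\<^sup>2 \<le> a n" for n
    using inner_ge_zero[of "u n - x"]
    by (simp add: a_def power2_norm_eq_inner inner_diff_left inner_diff_right inner_commute)
  have "limsup (\<lambda>n. ereal (P (u n) - 1/2 * (norm (u n))\<^sup>2)) \<le> limsup (\<lambda>n. ereal (a n) + ereal (P (u n)))"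
  proof (intro Limsup_mono always_eventually allI)
    show "ereal (P (u n) - 1/2 * (norm (u n))\<^sup>2) \<le> ereal (a n) + ereal (P (u n))" for n
      using le[of n] by simp
  qed
  also have "\<dots> = ereal (- (1/2) * (norm x)\<^sup>2) + limsup (\<lambda>n. ereal (P (u n)))"
    by (rule ereal_limsup_lim_add[OF a]) auto
  also have "\<dots> \<le> ereal (- (1/2) * (norm x)\<^sup>2) + ereal (P x)"
    using assms u unfolding seq_weakly_usc_def by (intro add_left_mono) blast
  finally show "limsup (\<lambda>n. ereal (P (u n) - 1/2 * (norm (u n))\<^sup>2)) \<le> ereal (P x - 1/2 * (norm x)\<^sup>2)"
    by simp
qed

section \<open>Minima of the functional on balls\<close>

text \<open>
  Fermat's rule on a single line: in the direction \<open>h = x - A x\<close> the derivative of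
  \<open>\<parallel>x\<parallel>\<^sup>2 / 2 - P x\<close> is \<open>h \<bullet> h\<close>, which has to vanish at a local minimum.
\<close>
lemma potential_local_min_imp_fixed_point:
  fixes A :: "'a::real_inner \<Rightarrow> 'a"
  assumes pot: "is_potential P A" and "e > 0"
    and min: "\<And>y. y \<in> ball x e \<Longrightarrow> 1/2 * (norm x)\<^sup>2 - P x \<le> 1/2 * (norm y)\<^sup>2 - P y"
  shows "A x = x"
proof (rule ccontr)
  assume "A x \<noteq> x"
  define h where "h = x - A x"
  have h: "norm h > 0" using \<open>A x \<noteq> x\<close> by (simp add: h_def)
  \<comment> \<open>The norm is expanded so that its square is visibly differentiable in \<open>t\<close>.\<close>
  define g where "g t = 1/2 * ((norm x)\<^sup>2 + 2 * t * (x \<bullet> h) + t\<^sup>2 * (norm h)\<^sup>2) - P (x + t *\<^sub>R h)" for t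
  have g: "g t = 1/2 * (norm (x + t *\<^sub>R h))\<^sup>2 - P (x + t *\<^sub>R h)" for t
    unfolding g_def power2_norm_eq_inner
    by (simp add: inner_add_left inner_add_right inner_commute power2_eq_square algebra_simps)
  have "((\<lambda>t. P (x + t *\<^sub>R h)) has_real_derivative A x \<bullet> h) (at 0)"
    using pot by (simp add: is_potential_def has_gateaux_derivative_def DERIV_def)
  then have "(g has_real_derivative (x \<bullet> h - A x \<bullet> h)) (at 0)"
    unfolding g_def by (auto intro!: derivative_eq_intros)
  moreover have "0 < e / norm h" using \<open>e > 0\<close> h by simp
  moreover have "g 0 \<le> g t" if "\<bar>0 - t\<bar> < e / norm h" for t
    using min[of "x + t *\<^sub>R h"] that h by (simp add: g dist_norm field_simps)
  ultimately have "x \<bullet> h - A x \<bullet> h = 0" by (blast intro: DERIV_local_min)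
  then have "h \<bullet> h = 0" by (simp add: h_def inner_diff_left)
  with h show False by simp
qed

text \<open>
  The condition on \<open>\<phi>(\<rho>)\<close> with the quotient cleared: \<open>x\<close> is a point where the quotient is below
  \<open>1/2\<close>. For \<open>y\<close> on the sphere \<open>\<parallel>y\<parallel>\<^sup>2 = \<rho>\<close> the right-hand side of the inequality is the value at
  \<open>y\<close> of the functional on the left.
\<close>
lemma phi_less_half_imp_value_below_sphere:
  assumes "phi P \<rho> < ereal (1/2)"
  shows "\<exists>x. (norm x)\<^sup>2 < \<rho> \<and> (\<forall>y. (norm y)\<^sup>2 \<le> \<rho> \<longrightarrow> 1/2 * (norm x)\<^sup>2 - P x < 1/2 * \<rho> - P y)"
proof -
  define S where "S = (SUP y \<in> {y. (norm y)\<^sup>2 \<le> \<rho>}. ereal (P y))"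
  from assms obtain x where x: "(norm x)\<^sup>2 < \<rho>"
    and lt: "(S - ereal (P x)) / ereal (\<rho> - (norm x)\<^sup>2) < ereal (1/2)"
    by (auto simp: phi_def INF_less_iff S_def)
  have "1/2 * (norm x)\<^sup>2 - P x < 1/2 * \<rho> - P y" if "(norm y)\<^sup>2 \<le> \<rho>" for y
  proof -
    have "ereal (P y) \<le> S" unfolding S_def using that by (intro SUP_upper) simp
    then have "(ereal (P y) - ereal (P x)) / ereal (\<rho> - (norm x)\<^sup>2) \<le> (S - ereal (P x)) / ereal (\<rho> - (norm x)\<^sup>2)"
      using x by (intro ereal_divide_right_mono ereal_minus_mono) auto
    also note lt
    finally have "(P y - P x) / (\<rho> - (norm x)\<^sup>2) < 1/2" using x by simp
    then show ?thesis using x by (simp add: field_simps)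
  qed
  with x show ?thesis by blast
qed

text \<open>
  A minimizer \<open>x\<close> over the closed ball satisfies \<open>\<parallel>x\<parallel>\<^sup>2 / 2 - P x \<le> \<parallel>z\<parallel>\<^sup>2 / 2 - P z < \<rho>/2 - P x\<close>
  for the point \<open>z\<close> of the previous lemma. So it is interior, and thus a fixed point.
\<close>
lemma phi_less_half_imp_fixed_point_minimum:
  fixes A :: "'a::{real_inner, complete_space} \<Rightarrow> 'a"
  assumes pot: "is_potential P A" and usc: "seq_weakly_usc P"
    and "\<rho> > 0" and phi: "phi P \<rho> < ereal (1/2)"
  shows "\<exists>x. A x = x \<and> norm x < sqrt \<rho> \<and>
    (\<forall>y\<in>cball 0 (sqrt \<rho>). 1/2 * (norm x)\<^sup>2 - P x \<le> 1/2 * (norm y)\<^sup>2 - P y)"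
proof -
  have ball: "(norm y)\<^sup>2 \<le> \<rho> \<longleftrightarrow> norm y \<le> sqrt \<rho>" for y :: 'a
    using real_le_rsqrt[of "norm y" \<rho>] real_sqrt_le_iff[of "(norm y)\<^sup>2" \<rho>] by auto
  obtain x where "x \<in> cball 0 (sqrt \<rho>)"
    and "\<forall>y\<in>cball 0 (sqrt \<rho>). P y - 1/2 * (norm y)\<^sup>2 \<le> P x - 1/2 * (norm x)\<^sup>2"
    using seq_weakly_usc_attains_sup_on_cball[OF seq_weakly_usc_diff_half_norm_power2[OF usc],
        of "sqrt \<rho>"] \<open>\<rho> > 0\<close> by auto
  then have x: "norm x \<le> sqrt \<rho>"
    and min: "\<And>y. norm y \<le> sqrt \<rho> \<Longrightarrow> 1/2 * (norm x)\<^sup>2 - P x \<le> 1/2 * (norm y)\<^sup>2 - P y"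
    by force+
  obtain z where z: "(norm z)\<^sup>2 < \<rho>" "1/2 * (norm z)\<^sup>2 - P z < 1/2 * \<rho> - P x"
    using phi_less_half_imp_value_below_sphere[OF phi] ball x by blast
  have "1/2 * (norm x)\<^sup>2 - P x \<le> 1/2 * (norm z)\<^sup>2 - P z" using min[of z] ball[of z] z(1) by simp
  with z(2) have "(norm x)\<^sup>2 < \<rho>" by simp
  then have less: "norm x < sqrt \<rho>" by (rule real_less_rsqrt)
  have "A x = x"
  proof (rule potential_local_min_imp_fixed_point[OF pot])
    show "0 < sqrt \<rho> - norm x" using less by simp
    fix y assume "y \<in> ball x (sqrt \<rho> - norm x)"
    then have "norm y \<le> sqrt \<rho>"
      using norm_triangle_sub[of y x] by (simp add: dist_norm norm_minus_commute)
    then show "1/2 * (norm x)\<^sup>2 - P x \<le> 1/2 * (norm y)\<^sup>2 - P y" by (rule min)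
  qed
  with less min show ?thesis by auto
qed

section \<open>Fixed points from the behaviour at infinity and at zero\<close>

lemma Liminf_less_imp_frequently_less:
  fixes f :: "'a \<Rightarrow> 'b::complete_linorder"
  assumes "Liminf F f < c"
  shows "\<exists>\<^sub>F x in F. f x < c"
proof (rule ccontr)
  assume "\<not> ?thesis"
  then have "c \<le> Liminf F f" by (intro Liminf_bounded) (simp add: not_frequently not_less)
  with assms show False by simp
qed

text \<open>
  Each term is chosen with less than half the norm of the one before, which makes the norms
  strictly decreasing, so that the terms are distinct, and sends them to zero.
\<close>
lemma injective_null_sequence_in_set:
  fixes S :: "'a::real_normed_vector set"
  assumes S: "\<And>e. e > 0 \<Longrightarrow> \<exists>x\<in>S. x \<noteq> 0 \<and> norm x < e"
  shows "\<exists>u::nat \<Rightarrow> 'a. inj u \<and> range u \<subseteq> S \<and> u \<longlonglongrightarrow> 0"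
proof -
  have "\<exists>x. (x \<in> S \<and> x \<noteq> 0) \<and> norm x < 1" using S[of 1] by auto
  moreover have "\<exists>y. (y \<in> S \<and> y \<noteq> 0) \<and> norm y < norm x / 2" if "x \<in> S \<and> x \<noteq> 0" for x
    using S[of "norm x / 2"] that by auto
  ultimately obtain u where u: "\<And>n. u n \<in> S \<and> u n \<noteq> 0" "\<And>n. norm (u (Suc n)) < norm (u n) / 2"
    using dependent_nat_choice[of "\<lambda>_ x. x \<in> S \<and> x \<noteq> 0" "\<lambda>_ x y. norm y < norm x / 2"] by auto
  have dec: "norm (u (Suc n)) < norm (u n)" for n using u(2)[of n] norm_ge_zero[of "u n"] by linarith
  have "inj u"
  proof (rule linorder_injI)
    fix m n :: nat assume "m < n"
    then have "norm (u n) < norm (u m)"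
      using dec by (rule_tac lift_Suc_mono_less[of "\<lambda>n. - norm (u n)" m n, simplified]) auto
    then show "u m \<noteq> u n" by auto
  qed
  moreover have "norm (u n) \<le> norm (u 0) * (1/2) ^ n" for n
  proof (induction n)
    case (Suc n)
    then show ?case using u(2)[of n] by simp
  qed simp
  then have "u \<longlonglongrightarrow> 0"
    by (intro Lim_null_comparison[OF always_eventually
          tendsto_mult_right_zero[OF LIMSEQ_realpow_zero[of "1/2"]]]) auto
  ultimately show ?thesis using u(1) by blast
qed

lemma LIMSEQ_imp_weakly_tendsto: "u \<longlonglongrightarrow> x \<Longrightarrow> weakly_tendsto u x"
  unfolding weakly_tendsto_def by (blast intro: bounded_linear.tendsto)


theorem theorem2p7:
  fixes A :: "'a::{real_inner, complete_space} \<Rightarrow> 'a" and P :: "'a \<Rightarrow> real"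
    and \<gamma> \<delta> :: ereal
  assumes "potential_operator A"
    and "is_potential P A"
    and "seq_weakly_usc P"
    and "\<gamma> = Liminf at_top (phi P)"
    and "\<delta> = Liminf (at_right 0) (phi P)"
  shows
    "(\<forall>\<rho>>0. phi P \<rho> < ereal (1/2) \<longrightarrow> (\<exists>x. A x = x \<and> norm x < sqrt \<rho>)) \<and>
     (\<gamma> < ereal (1/2) \<longrightarrow>
        (\<exists>x. \<forall>y. 1/2 * (norm x)\<^sup>2 - P x \<le> 1/2 * (norm y)\<^sup>2 - P y) \<or>
        \<not> bounded {x. A x = x}) \<and>
     (\<delta> < ereal (1/2) \<longrightarrow>
        (\<forall>\<^sub>F x in nhds 0. 1/2 * (norm (0::'a))\<^sup>2 - P 0 \<le> 1/2 * (norm x)\<^sup>2 - P x) \<or>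
        (\<exists>u :: nat \<Rightarrow> 'a. inj u \<and> (\<forall>n. A (u n) = u n) \<and> weakly_tendsto u 0))"
proof -
  let ?J = "\<lambda>x. 1/2 * (norm x)\<^sup>2 - P x"
  note fixed_min = phi_less_half_imp_fixed_point_minimum[OF assms(2,3)]
  have a: "\<exists>x. A x = x \<and> norm x < sqrt \<rho>" if "\<rho> > 0" "phi P \<rho> < ereal (1/2)" for \<rho>
    using fixed_min[OF that] by blast
  have b: "\<exists>x. \<forall>y. ?J x \<le> ?J y" if \<gamma>: "\<gamma> < ereal (1/2)" and "bounded {x. A x = x}"
  proof -
    from that(2) obtain M where M: "\<And>x. A x = x \<Longrightarrow> norm x \<le> M" by (auto simp: bounded_iff)
    have large: "\<exists>\<rho>>0. R \<le> sqrt \<rho> \<and> phi P \<rho> < ereal (1/2)" for R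
    proof -
      have "\<forall>\<^sub>F \<rho> in at_top. 0 < \<rho> \<and> R\<^sup>2 \<le> \<rho>"
        by (intro eventually_conj eventually_gt_at_top eventually_ge_at_top)
      from frequently_ex[OF frequently_eventually_frequently
          [OF Liminf_less_imp_frequently_less[OF \<gamma>[unfolded assms(4)]] this]]
      show ?thesis using real_le_rsqrt by blast
    qed
    obtain \<rho> where \<rho>: "\<rho> > 0" "M \<le> sqrt \<rho>" "phi P \<rho> < ereal (1/2)" using large by blast
    obtain x where x: "\<forall>y\<in>cball 0 (sqrt \<rho>). ?J x \<le> ?J y" using fixed_min[OF \<rho>(1,3)] by blast
    \<comment> \<open>The minimizer \<open>z\<close> over an admissible ball containing \<open>y\<close> is a fixed point, so it competes with \<open>x\<close>.\<close>
    have "?J x \<le> ?J y" for y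
    proof -
      obtain \<sigma> where \<sigma>: "\<sigma> > 0" "norm y \<le> sqrt \<sigma>" "phi P \<sigma> < ereal (1/2)" using large by blast
      obtain z where z: "A z = z" "\<forall>y\<in>cball 0 (sqrt \<sigma>). ?J z \<le> ?J y"
        using fixed_min[OF \<sigma>(1,3)] by blast
      have "z \<in> cball 0 (sqrt \<rho>)" using M[OF z(1)] \<rho>(2) by simp
      with x have "?J x \<le> ?J z" by blast
      also have "\<dots> \<le> ?J y" using z(2) \<sigma>(2) by simp
      finally show ?thesis .
    qed
    then show ?thesis by blast
  qed
  have c: "\<exists>u :: nat \<Rightarrow> 'a. inj u \<and> (\<forall>n. A (u n) = u n) \<and> weakly_tendsto u 0"
    if \<delta>: "\<delta> < ereal (1/2)" and nmin: "\<not> (\<forall>\<^sub>F x in nhds 0. ?J 0 \<le> ?J x)"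
  proof -
    have "\<exists>x\<in>{x. A x = x}. x \<noteq> 0 \<and> norm x < e" if "e > 0" for e
    proof -
      have "\<forall>\<^sub>F \<rho> in at_right 0. 0 < \<rho> \<and> \<rho> < e\<^sup>2"
        using \<open>e > 0\<close> by (auto simp: eventually_at_right intro!: exI[of _ "e\<^sup>2"])
      from frequently_ex[OF frequently_eventually_frequently
          [OF Liminf_less_imp_frequently_less[OF \<delta>[unfolded assms(5)]] this]]
      obtain \<rho> where \<rho>: "0 < \<rho>" "\<rho> < e\<^sup>2" "phi P \<rho> < ereal (1/2)" by blast
      obtain x where x: "A x = x" "norm x < sqrt \<rho>" "\<forall>y\<in>cball 0 (sqrt \<rho>). ?J x \<le> ?J y"
        using fixed_min[OF \<rho>(1,3)] by blast
      have "sqrt \<rho> < e" using \<rho>(2) \<open>e > 0\<close> by (simp add: real_less_lsqrt \<rho>(1) less_imp_le)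
      \<comment> \<open>If the minimizer over the ball were \<open>0\<close>, then \<open>0\<close> would be a local minimum.\<close>
      moreover have "x \<noteq> 0"
      proof
        assume "x = 0"
        have "\<forall>\<^sub>F y in nhds 0. y \<in> ball (0::'a) (sqrt \<rho>)"
          using \<rho>(1) by (intro eventually_nhds_in_open) auto
        then have "\<forall>\<^sub>F y in nhds 0. ?J 0 \<le> ?J y"
          by eventually_elim (use x(3) \<open>x = 0\<close> in auto)
        with nmin show False by blast
      qed
      ultimately show ?thesis using x(1,2) by force
    qed
    from injective_null_sequence_in_set[OF this] show ?thesis
      using LIMSEQ_imp_weakly_tendsto by blast
  qed
  show ?thesis using a b c by blast
qed

end
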